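(* Let $\mathbf{C}$ be a category with pullbacks, with a stable system of monos $\mathcal{M}$ and an $\mathcal{M}$-partial map classifier $(T,\eta)$. Let $l:K\to L$ be an arrow of $\mathbf{C}$ and $m:L\rightarrowtail G$ a mono in $\mathcal{M}$. Let $G\xleftarrow{a}D\xrightarrow{n'}T(K)$ be the pullback of $G\xrightarrow{\overline{m}}T(L)\xleftarrow{T(l)}T(K)$, and let $n:K\to D$ be the unique arrow with $n'\circ n=\eta_K$ and $a\circ n=m\circ l$. Then $K\xrightarrow{n}D\xrightarrow{a}G$ is a final pullback complement of $K\xrightarrow{l}L\xrightarrow{m}G$.
   Context: A stable system of monos $\mathcal{M}$ is a class of monos containing all isomorphisms, closed under composition, and stable under pullback: if $(f',m')$ is a pullback of $(m,f)$ with $m\in\mathcal{M}$ then $m'\in\mathcal{M}$. An $\mathcal{M}$-partial map classifier is a functor $T:\mathbf{C}\to\mathbf{C}$ with a natural transformation $\eta:\mathrm{Id}\Rightarrow T$ such that for every span $Z\xleftarrow{m}X\xrightarrow{f}Y$ with $m\in\mathcal{M}$ there is a unique arrow $\varphi(m,f):Z\to T(Y)$ making the square $\varphi(m,f)\circ m=\eta_Y\circ f$ a pullback. For $m:X\rightarrowtail Z$ in $\mathcal{M}$ write $\overline{m}=\varphi(m,\mathrm{id}_X):Z\to T(X)$. Final pullback complement: $K\xrightarrow{n}D\xrightarrow{a}G$ is a final pullback complement of $K\xrightarrow{l}L\xrightarrow{m}G$ if (1) $a\circ n=m\circ l$ is a pullback square, and (2) for every pullback square $m\circ d=f\circ e$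 with $d:K'\to L$, $e:K'\to D'$, $f:D'\to G$, and every arrow $h:K'\to K$ with $l\circ h=d$, there is a unique arrow $g:D'\to D$ with $a\circ g=f$ and $g\circ e=n\circ h$.
   Formalization: The formal theorem additionally assumes that η is cartesian (its naturality squares are pullbacks); without this the claim fails, e.g. for the poset 0<1, M the identities, T constant at 1, l: 0→1 and m the identity of 1. *)

theory Defs
  imports Main
begin

text \<open>
  A category has a set of objects and a set of arrows inside two types. The operations are total
  functions, about which nothing is assumed outside these sets or on non-composable arrows;
  \<open>g \<cdot> f\<close> means first \<open>f\<close>, then \<open>g\<close>.
\<close>

record ('o, 'a) cat_data =
  Obj :: "'o set"
  Arr :: "'a set"
  Dom :: "'a \<Rightarrow> 'o"
  Cod :: "'a \<Rightarrow> 'o"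
  Id :: "'o \<Rightarrow> 'a"
  Comp :: "'a \<Rightarrow> 'a \<Rightarrow> 'a"  (infixr \<open>\<cdot>\<index>\<close> 70)

definition hom :: "('o, 'a) cat_data \<Rightarrow> 'o \<Rightarrow> 'o \<Rightarrow> 'a set" where
  "hom C X Y = {f \<in> Arr C. Dom C f = X \<and> Cod C f = Y}"

locale category =
  fixes C :: "('o, 'a) cat_data" (structure)
  assumes Dom_Obj: "f \<in> Arr C \<Longrightarrow> Dom C f \<in> Obj C"
    and Cod_Obj: "f \<in> Arr C \<Longrightarrow> Cod C f \<in> Obj C"
    and Id_hom: "X \<in> Obj C \<Longrightarrow> Id C X \<in> hom C X X"
    and Comp_hom: "f \<in> hom C X Y \<Longrightarrow> g \<in> hom C Y Z \<Longrightarrow> g \<cdot> f \<in> hom C X Z"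
    and Comp_Id: "f \<in> hom C X Y \<Longrightarrow> f \<cdot> Id C X = f"
    and Id_Comp: "f \<in> hom C X Y \<Longrightarrow> Id C Y \<cdot> f = f"
    and Comp_assoc: "f \<in> hom C W X \<Longrightarrow> g \<in> hom C X Y \<Longrightarrow> h \<in> hom C Y Z \<Longrightarrow>
      (h \<cdot> g) \<cdot> f = h \<cdot> (g \<cdot> f)"

definition is_mono :: "('o, 'a) cat_data \<Rightarrow> 'a \<Rightarrow> bool" where
  "is_mono C m \<longleftrightarrow> m \<in> Arr C \<and>
    (\<forall>W. \<forall>u \<in> hom C W (Dom C m). \<forall>v \<in> hom C W (Dom C m). m \<cdot>\<^bsub>C\<^esub> u = m \<cdot>\<^bsub>C\<^esub> v \<longrightarrow> u = v)"

definition is_iso :: "('o, 'a) cat_data \<Rightarrow> 'a \<Rightarrow> bool" where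
  "is_iso C f \<longleftrightarrow> f \<in> Arr C \<and>
    (\<exists>g \<in> hom C (Cod C f) (Dom C f). g \<cdot>\<^bsub>C\<^esub> f = Id C (Dom C f) \<and> f \<cdot>\<^bsub>C\<^esub> g = Id C (Cod C f))"

text \<open>
  \<open>is_pullback C f g p q\<close>: the square \<open>f \<cdot> p = g \<cdot> q\<close> is a pullback of the cospan \<open>(f, g)\<close>,
  with projections \<open>p\<close> and \<open>q\<close> to the domains of \<open>f\<close> and \<open>g\<close>, respectively.
\<close>

definition is_pullback :: "('o, 'a) cat_data \<Rightarrow> 'a \<Rightarrow> 'a \<Rightarrow> 'a \<Rightarrow> 'a \<Rightarrow> bool" where
  "is_pullback C f g p q \<longleftrightarrow>
    f \<in> Arr C \<and> g \<in> Arr C \<and> Cod C f = Cod C g \<and>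
    p \<in> hom C (Dom C p) (Dom C f) \<and> q \<in> hom C (Dom C p) (Dom C g) \<and>
    f \<cdot>\<^bsub>C\<^esub> p = g \<cdot>\<^bsub>C\<^esub> q \<and>
    (\<forall>W. \<forall>u \<in> hom C W (Dom C f). \<forall>v \<in> hom C W (Dom C g). f \<cdot>\<^bsub>C\<^esub> u = g \<cdot>\<^bsub>C\<^esub> v \<longrightarrow>
      (\<exists>!h. h \<in> hom C W (Dom C p) \<and> p \<cdot>\<^bsub>C\<^esub> h = u \<and> q \<cdot>\<^bsub>C\<^esub> h = v))"

definition has_pullbacks :: "('o, 'a) cat_data \<Rightarrow> bool" where
  "has_pullbacks C \<longleftrightarrow>
    (\<forall>f \<in> Arr C. \<forall>g \<in> Arr C. Cod C f = Cod C g \<longrightarrow> (\<exists>p q. is_pullback C f g p q))"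

locale stable_system_of_monos = category C
  for C :: "('o, 'a) cat_data" (structure) +
  fixes M :: "'a set"
  assumes mono: "m \<in> M \<Longrightarrow> is_mono C m"
    and iso: "is_iso C f \<Longrightarrow> f \<in> M"
    and comp: "m \<in> M \<Longrightarrow> m' \<in> M \<Longrightarrow> Cod C m = Dom C m' \<Longrightarrow> m' \<cdot> m \<in> M"
    and pullback_stable: "m \<in> M \<Longrightarrow> is_pullback C m f f' m' \<Longrightarrow> m' \<in> M"

record ('o, 'a, 'p, 'b) functor_data =
  FObj :: "'o \<Rightarrow> 'p"
  FArr :: "'a \<Rightarrow> 'b"

locale cat_functor = A: category A + B: category B
  for A :: "('o, 'a) cat_data" and B :: "('p, 'b) cat_data" +
  fixes F :: "('o, 'a, 'p, 'b) functor_data"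
  assumes FObj_Obj: "X \<in> Obj A \<Longrightarrow> FObj F X \<in> Obj B"
    and FArr_hom: "f \<in> hom A X Y \<Longrightarrow> FArr F f \<in> hom B (FObj F X) (FObj F Y)"
    and FArr_Id: "X \<in> Obj A \<Longrightarrow> FArr F (Id A X) = Id B (FObj F X)"
    and FArr_Comp: "f \<in> hom A X Y \<Longrightarrow> g \<in> hom A Y Z \<Longrightarrow>
      FArr F (g \<cdot>\<^bsub>A\<^esub> f) = FArr F g \<cdot>\<^bsub>B\<^esub> FArr F f"

definition id_functor :: "('o, 'a, 'o, 'a) functor_data" where
  "id_functor = \<lparr>FObj = (\<lambda>X. X), FArr = (\<lambda>f. f)\<rparr>"

locale natural_transformation = F: cat_functor A B F + G: cat_functor A B G
  for A :: "('o, 'a) cat_data" and B :: "('p, 'b) cat_data"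
    and F :: "('o, 'a, 'p, 'b) functor_data" and G :: "('o, 'a, 'p, 'b) functor_data" +
  fixes \<eta> :: "'o \<Rightarrow> 'b"
  assumes component_hom: "X \<in> Obj A \<Longrightarrow> \<eta> X \<in> hom B (FObj F X) (FObj G X)"
    and naturality: "f \<in> hom A X Y \<Longrightarrow> \<eta> Y \<cdot>\<^bsub>B\<^esub> FArr F f = FArr G f \<cdot>\<^bsub>B\<^esub> \<eta> X"

locale cartesian_transformation = natural_transformation A B F G \<eta>
  for A :: "('o, 'a) cat_data" and B :: "('p, 'b) cat_data"
    and F :: "('o, 'a, 'p, 'b) functor_data" and G :: "('o, 'a, 'p, 'b) functor_data"
    and \<eta> :: "'o \<Rightarrow> 'b" +
  assumes naturality_pullback: "f \<in> hom A X Y \<Longrightarrow>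
    is_pullback B (FArr G f) (\<eta> Y) (\<eta> X) (FArr F f)"

definition is_classifying_arrow ::
  "('o, 'a) cat_data \<Rightarrow> ('o, 'a, 'o, 'a) functor_data \<Rightarrow> ('o \<Rightarrow> 'a) \<Rightarrow> 'a \<Rightarrow> 'a \<Rightarrow> 'a \<Rightarrow> bool" where
  "is_classifying_arrow C T \<eta> m f u \<longleftrightarrow>
    u \<in> hom C (Cod C m) (FObj T (Cod C f)) \<and> is_pullback C u (\<eta> (Cod C f)) m f"

text \<open>
  The universal property of \<open>T\<close> does not make \<open>\<eta>\<close> cartesian, that is, it does not force \<open>FArr T f\<close> to be a classifying arrow
  of the span \<open>(\<eta> X, f)\<close>, as it is when \<open>T\<close> is built from the classifying objects. For
  example, in the poset \<open>0 < 1\<close> with \<open>M\<close> its identities, the constant functor \<open>1\<close> satisfies the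
  definition, but the naturality square of \<open>0 \<rightarrow> 1\<close> is not a pullback. Hence
  \<open>cartesian_transformation\<close> is a separate condition.
\<close>

locale partial_map_classifier =
  stable_system_of_monos C M + natural_transformation C C id_functor T \<eta>
  for C :: "('o, 'a) cat_data" (structure) and M :: "'a set"
    and T :: "('o, 'a, 'o, 'a) functor_data" and \<eta> :: "'o \<Rightarrow> 'a" +
  assumes classifies: "m \<in> M \<Longrightarrow> f \<in> Arr C \<Longrightarrow> Dom C m = Dom C f \<Longrightarrow>
    \<exists>!u. is_classifying_arrow C T \<eta> m f u"

definition classifying_arrow ::
  "('o, 'a) cat_data \<Rightarrow> ('o, 'a, 'o, 'a) functor_data \<Rightarrow> ('o \<Rightarrow> 'a) \<Rightarrow> 'a \<Rightarrow> 'a \<Rightarrow> 'a" where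
  "classifying_arrow C T \<eta> m f = (THE u. is_classifying_arrow C T \<eta> m f u)"

definition mono_classifier ::
  "('o, 'a) cat_data \<Rightarrow> ('o, 'a, 'o, 'a) functor_data \<Rightarrow> ('o \<Rightarrow> 'a) \<Rightarrow> 'a \<Rightarrow> 'a" where
  "mono_classifier C T \<eta> m = classifying_arrow C T \<eta> m (Id C (Dom C m))"

text \<open>
  \<open>is_final_pullback_complement C l m n a\<close>: \<open>K \<rightarrow> D \<rightarrow> G\<close>, given by \<open>n\<close> and \<open>a\<close>, is a final
  pullback complement of \<open>K \<rightarrow> L \<rightarrow> G\<close>, given by \<open>l\<close> and \<open>m\<close>.
\<close>

definition is_final_pullback_complement ::
  "('o, 'a) cat_data \<Rightarrow> 'a \<Rightarrow> 'a \<Rightarrow> 'a \<Rightarrow> 'a \<Rightarrow> bool" where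
  "is_final_pullback_complement C l m n a \<longleftrightarrow>
    is_pullback C a m n l \<and>
    (\<forall>d e f h. is_pullback C m f d e \<and> h \<in> hom C (Dom C d) (Dom C l) \<and> l \<cdot>\<^bsub>C\<^esub> h = d \<longrightarrow>
      (\<exists>!g. g \<in> hom C (Dom C f) (Dom C a) \<and> a \<cdot>\<^bsub>C\<^esub> g = f \<and> g \<cdot>\<^bsub>C\<^esub> e = n \<cdot>\<^bsub>C\<^esub> h))"

end

theory Submission
  imports Defs
begin

text \<open>
  Pullback pasting and its converse reduce everything to the uniqueness of classifying arrows.
  Put \<open>c = mono_classifier C T \<eta> m\<close>. The square \<open>a \<cdot> n = m \<cdot> l\<close>, pasted with the one defining
  \<open>D\<close>, is the naturality square of \<open>\<eta>\<close> at \<open>l\<close>, hence it is a pullback. For a pullback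
  \<open>m \<cdot> d = f \<cdot> e\<close> and \<open>l \<cdot> h = d\<close>, both \<open>c \<cdot> f\<close> and \<open>FArr T l \<cdot> p\<close> classify the span
  \<open>(e, d)\<close>, where \<open>p\<close> classifies \<open>(e, h)\<close>; so \<open>f\<close> and \<open>p\<close> induce the required \<open>g\<close>.
  Conversely, for every admissible \<open>g\<close> the arrow \<open>n' \<cdot> g\<close> classifies \<open>(e, h)\<close>, and therefore it is \<open>p\<close>.
\<close>

section \<open>Pullback squares with explicitly named objects\<close>

lemma homD:
  assumes "f \<in> hom C X Y"
  shows "f \<in> Arr C" "Dom C f = X" "Cod C f = Y"
  using assms by (simp_all add: hom_def)

lemma is_pullback_commutes: "is_pullback C f g p q \<Longrightarrow> f \<cdot>\<^bsub>C\<^esub> p = g \<cdot>\<^bsub>C\<^esub> q"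
  by (simp add: is_pullback_def)

lemma is_pullback_hom:
  assumes "is_pullback C f g p q"
  obtains P X Y Z where "f \<in> hom C X Z" "g \<in> hom C Y Z" "p \<in> hom C P X" "q \<in> hom C P Y"
proof (rule that)
  show "f \<in> hom C (Dom C f) (Cod C f)" "g \<in> hom C (Dom C g) (Cod C f)"
    "p \<in> hom C (Dom C p) (Dom C f)" "q \<in> hom C (Dom C p) (Dom C g)"
    using assms by (simp_all add: is_pullback_def hom_def)
qed

text \<open>Naming the objects instead of writing \<open>Dom\<close> and \<open>Cod\<close> lets the
  \<open>hom\<close> facts be passed directly by \<open>OF\<close>.\<close>

lemma is_pullback_ex1:
  assumes "is_pullback C f g p q" "f \<in> hom C X Z" "g \<in> hom C Y Z" "p \<in> hom C P X"
    and "u \<in> hom C W X" "v \<in> hom C W Y" "f \<cdot>\<^bsub>C\<^esub> u = g \<cdot>\<^bsub>C\<^esub> v"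
  shows "\<exists>!h. h \<in> hom C W P \<and> p \<cdot>\<^bsub>C\<^esub> h = u \<and> q \<cdot>\<^bsub>C\<^esub> h = v"
  using assms(1,5-7) unfolding is_pullback_def homD(2)[OF assms(2)] homD(2)[OF assms(3)]
    homD(2)[OF assms(4)]
  by blast

lemma is_pullbackI:
  assumes "f \<in> hom C X Z" "g \<in> hom C Y Z" "p \<in> hom C P X" "q \<in> hom C P Y"
    and "f \<cdot>\<^bsub>C\<^esub> p = g \<cdot>\<^bsub>C\<^esub> q"
    and "\<And>W u v. u \<in> hom C W X \<Longrightarrow> v \<in> hom C W Y \<Longrightarrow> f \<cdot>\<^bsub>C\<^esub> u = g \<cdot>\<^bsub>C\<^esub> v \<Longrightarrow>
      \<exists>!h. h \<in> hom C W P \<and> p \<cdot>\<^bsub>C\<^esub> h = u \<and> q \<cdot>\<^bsub>C\<^esub> h = v"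
  shows "is_pullback C f g p q"
  unfolding is_pullback_def homD[OF assms(1)] homD[OF assms(2)] homD(2)[OF assms(3)]
  by (intro conjI allI ballI impI refl TrueI homD(1)[OF assms(1)] homD(1)[OF assms(2)] assms)

lemma is_pullback_swap:
  assumes "is_pullback C f g p q"
  shows "is_pullback C g f q p"
proof -
  obtain P X Y Z where homs: "f \<in> hom C X Z" "g \<in> hom C Y Z" "p \<in> hom C P X" "q \<in> hom C P Y"
    by (rule is_pullback_hom[OF assms])
  show ?thesis
  proof (rule is_pullbackI[OF homs(2,1,4,3) is_pullback_commutes[OF assms, symmetric]])
    fix W u v
    assume "u \<in> hom C W Y" "v \<in> hom C W X" "g \<cdot>\<^bsub>C\<^esub> u = f \<cdot>\<^bsub>C\<^esub> v"
    then have "\<exists>!h. h \<in> hom C W P \<and> p \<cdot>\<^bsub>C\<^esub> h = v \<and> q \<cdot>\<^bsub>C\<^esub> h = u"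
      by (intro is_pullback_ex1[OF assms homs(1-3)]) (simp_all only:)
    then show "\<exists>!h. h \<in> hom C W P \<and> q \<cdot>\<^bsub>C\<^esub> h = u \<and> p \<cdot>\<^bsub>C\<^esub> h = v"
      by blast
  qed
qed

text \<open>The projections of a pullback are jointly monic: \<open>h\<close> and \<open>k\<close>
  both mediate the cone with legs \<open>p \<cdot> k\<close> and \<open>q \<cdot> k\<close>.\<close>

lemma is_pullback_cancel_arrow:
  assumes "is_pullback C f g p q" "f \<in> hom C X Z" "g \<in> hom C Y Z"
    and "category C" "p \<in> hom C P X" "q \<in> hom C P Y"
    and "h \<in> hom C W P" "k \<in> hom C W P" "p \<cdot>\<^bsub>C\<^esub> h = p \<cdot>\<^bsub>C\<^esub> k" "q \<cdot>\<^bsub>C\<^esub> h = q \<cdot>\<^bsub>C\<^esub> k"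
  shows "h = k"
proof -
  interpret category C by fact
  have "f \<cdot>\<^bsub>C\<^esub> (p \<cdot>\<^bsub>C\<^esub> k) = g \<cdot>\<^bsub>C\<^esub> (q \<cdot>\<^bsub>C\<^esub> k)"
    using Comp_assoc[OF assms(8,5,2)] Comp_assoc[OF assms(8,6,3)] is_pullback_commutes[OF assms(1)]
    by simp
  then have "\<exists>!i. i \<in> hom C W P \<and> p \<cdot>\<^bsub>C\<^esub> i = p \<cdot>\<^bsub>C\<^esub> k \<and> q \<cdot>\<^bsub>C\<^esub> i = q \<cdot>\<^bsub>C\<^esub> k"
    by (rule is_pullback_ex1[OF assms(1-3,5) Comp_hom[OF assms(8,5)] Comp_hom[OF assms(8,6)]])
  then show ?thesis
    using assms(7-10) by blast
qed

section \<open>Pasting pullback squares and its converse\<close>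

context category
begin

text \<open>The mediating arrow arises in two stages: \<open>u \<cdot> x\<close> and
  \<open>y\<close> induce \<open>z\<close> into \<open>A\<close>, then \<open>x\<close> and
  \<open>z\<close> induce \<open>h\<close> into \<open>P\<close>. Uniqueness follows by joint
  monicity in each square.\<close>

lemma is_pullback_paste:
  assumes right: "is_pullback C v g p q" and left: "is_pullback C u p p' q'"
    and v: "v \<in> hom C Y Z" and g: "g \<in> hom C B Z" and p: "p \<in> hom C A Y" and q: "q \<in> hom C A B"
    and u: "u \<in> hom C X Y" and p': "p' \<in> hom C P X" and q': "q' \<in> hom C P A"
  shows "is_pullback C (v \<cdot> u) g p' (q \<cdot> q')"
proof (rule is_pullbackI[OF Comp_hom[OF u v] g p' Comp_hom[OF q' q]])
  have "(v \<cdot> u) \<cdot> p' = v \<cdot> (p \<cdot> q')"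
    using Comp_assoc[OF p' u v] is_pullback_commutes[OF left] by simp
  also have "\<dots> = g \<cdot> (q \<cdot> q')"
    using Comp_assoc[OF q' p v] Comp_assoc[OF q' q g] is_pullback_commutes[OF right] by simp
  finally show "(v \<cdot> u) \<cdot> p' = g \<cdot> (q \<cdot> q')" .
next
  fix W x y
  assume x: "x \<in> hom C W X" and y: "y \<in> hom C W B" and eq: "(v \<cdot> u) \<cdot> x = g \<cdot> y"
  have "v \<cdot> (u \<cdot> x) = g \<cdot> y"
    using eq Comp_assoc[OF x u v] by simp
  then obtain z where z: "z \<in> hom C W A" "p \<cdot> z = u \<cdot> x" "q \<cdot> z = y"
    using is_pullback_ex1[OF right v g p Comp_hom[OF x u] y] by blast
  then obtain h where h: "h \<in> hom C W P" "p' \<cdot> h = x" "q' \<cdot> h = z"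
    using is_pullback_ex1[OF left u p p' x z(1)] z(2) by auto
  show "\<exists>!h. h \<in> hom C W P \<and> p' \<cdot> h = x \<and> (q \<cdot> q') \<cdot> h = y"
  proof (rule ex1I)
    show "h \<in> hom C W P \<and> p' \<cdot> h = x \<and> (q \<cdot> q') \<cdot> h = y"
      using h z(3) Comp_assoc[OF h(1) q' q] by simp
  next
    fix k
    assume k: "k \<in> hom C W P \<and> p' \<cdot> k = x \<and> (q \<cdot> q') \<cdot> k = y"
    then have k': "k \<in> hom C W P" by simp
    have "p \<cdot> (q' \<cdot> k) = u \<cdot> x"
      using k Comp_assoc[OF k' q' p] Comp_assoc[OF k' p' u] is_pullback_commutes[OF left] by simp
    moreover have "q \<cdot> (q' \<cdot> k) = y"
      using k Comp_assoc[OF k' q' q] by simp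
    ultimately have "q' \<cdot> k = z"
      using is_pullback_cancel_arrow[OF right v g category_axioms p q Comp_hom[OF k' q'] z(1)] z
      by simp
    then show "k = h"
      using is_pullback_cancel_arrow[OF left u p category_axioms p' q' k' h(1)] k h by simp
  qed
qed

text \<open>Composing \<open>y\<close> with \<open>q\<close> turns a cone over \<open>u\<close> and
  \<open>p\<close> into one over the outer rectangle, which supplies \<open>h\<close>. Joint
  monicity of \<open>p\<close> and \<open>q\<close> then improves
  \<open>q \<cdot> (q' \<cdot> h) = q \<cdot> y\<close> to \<open>q' \<cdot> h = y\<close>.\<close>

lemma is_pullback_left:
  assumes right: "is_pullback C v g p q" and outer: "is_pullback C (v \<cdot> u) g p' (q \<cdot> q')"
    and comm: "u \<cdot> p' = p \<cdot> q'"
    and v: "v \<in> hom C Y Z" and g: "g \<in> hom C B Z" and p: "p \<in> hom C A Y" and q: "q \<in> hom C A B"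
    and u: "u \<in> hom C X Y" and p': "p' \<in> hom C P X" and q': "q' \<in> hom C P A"
  shows "is_pullback C u p p' q'"
proof (rule is_pullbackI[OF u p p' q' comm])
  fix W x y
  assume x: "x \<in> hom C W X" and y: "y \<in> hom C W A" and eq: "u \<cdot> x = p \<cdot> y"
  have "(v \<cdot> u) \<cdot> x = g \<cdot> (q \<cdot> y)"
    using eq Comp_assoc[OF x u v] Comp_assoc[OF y p v] Comp_assoc[OF y q g]
      is_pullback_commutes[OF right] by simp
  then obtain h where h: "h \<in> hom C W P" "p' \<cdot> h = x" "(q \<cdot> q') \<cdot> h = q \<cdot> y"
    using is_pullback_ex1[OF outer Comp_hom[OF u v] g p' x Comp_hom[OF y q]] by blast
  have "p \<cdot> (q' \<cdot> h) = p \<cdot> y"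
    using eq h(2) comm Comp_assoc[OF h(1) q' p] Comp_assoc[OF h(1) p' u] by simp
  moreover have "q \<cdot> (q' \<cdot> h) = q \<cdot> y"
    using h(3) Comp_assoc[OF h(1) q' q] by simp
  ultimately have "q' \<cdot> h = y"
    using is_pullback_cancel_arrow[OF right v g category_axioms p q Comp_hom[OF h(1) q'] y] by simp
  show "\<exists>!h. h \<in> hom C W P \<and> p' \<cdot> h = x \<and> q' \<cdot> h = y"
  proof (rule ex1I)
    show "h \<in> hom C W P \<and> p' \<cdot> h = x \<and> q' \<cdot> h = y"
      using h \<open>q' \<cdot> h = y\<close> by simp
  next
    fix k
    assume k: "k \<in> hom C W P \<and> p' \<cdot> k = x \<and> q' \<cdot> k = y"
    then have k': "k \<in> hom C W P" by simp
    have "(q \<cdot> q') \<cdot> k = q \<cdot> y"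
      using k Comp_assoc[OF k' q' q] by simp
    then show "k = h"
      using is_pullback_cancel_arrow[OF outer Comp_hom[OF u v] g category_axioms p'
          Comp_hom[OF q' q] k' h(1)] k h by simp
  qed
qed

end

section \<open>Classifying arrows\<close>

context partial_map_classifier
begin

lemma classifying_arrow_ex1:
  assumes "m \<in> M" "m \<in> hom C X Z" "f \<in> hom C X Y"
  shows "\<exists>!u. u \<in> hom C Z (FObj T Y) \<and> is_pullback C u (\<eta> Y) m f"
  using classifies[OF assms(1), of f] assms(2,3)
  by (simp add: is_classifying_arrow_def homD)

lemma mono_classifier:
  assumes "m \<in> M" "m \<in> hom C L G"
  shows "mono_classifier C T \<eta> m \<in> hom C G (FObj T L)"
    and "is_pullback C (mono_classifier C T \<eta> m) (\<eta> L) m (Id C L)"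
proof -
  have Id: "Id C L \<in> hom C L L"
    using Id_hom Dom_Obj[of m] homD[OF assms(2)] by simp
  have "is_classifying_arrow C T \<eta> m (Id C L) (mono_classifier C T \<eta> m)"
    unfolding mono_classifier_def classifying_arrow_def homD(2)[OF assms(2)]
    by (rule theI'[OF classifies]) (simp_all add: assms(1) homD[OF Id] homD[OF assms(2)])
  then show "mono_classifier C T \<eta> m \<in> hom C G (FObj T L)"
    and "is_pullback C (mono_classifier C T \<eta> m) (\<eta> L) m (Id C L)"
    by (simp_all add: is_classifying_arrow_def homD[OF Id] homD[OF assms(2)])
qed

end

theorem theorem1:
  fixes C :: "('o, 'a) cat_data" (structure)
    and M :: "'a set"
    and T :: "('o, 'a, 'o, 'a) functor_data"
    and \<eta> :: "'o \<Rightarrow> 'a"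
    and K L G D :: 'o
    and l m a n' :: 'a
  assumes "category C"
    and "has_pullbacks C"
    and "stable_system_of_monos C M"
    and "partial_map_classifier C M T \<eta>"
    and "cartesian_transformation C C id_functor T \<eta>"
    and "l \<in> hom C K L"
    and "m \<in> hom C L G" and "m \<in> M"
    and "a \<in> hom C D G" and "n' \<in> hom C D (FObj T K)"
    and "is_pullback C (mono_classifier C T \<eta> m) (FArr T l) a n'"
  shows "(\<exists>!n. n \<in> hom C K D \<and> n' \<cdot> n = \<eta> K \<and> a \<cdot> n = m \<cdot> l) \<and>
    (\<forall>n. n \<in> hom C K D \<and> n' \<cdot> n = \<eta> K \<and> a \<cdot> n = m \<cdot> l \<longrightarrow>
      is_final_pullback_complement C l m n a)"
proof -
  interpret partial_map_classifier C M T \<eta> by fact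
  interpret cart: cartesian_transformation C C id_functor T \<eta> by fact
  define c where "c = mono_classifier C T \<eta> m"
  have l: "l \<in> hom C K L" and m: "m \<in> hom C L G" and a: "a \<in> hom C D G"
    and n': "n' \<in> hom C D (FObj T K)"
    by fact+
  have Tl: "FArr T l \<in> hom C (FObj T K) (FObj T L)"
    by (rule G.FArr_hom[OF l])
  have K: "K \<in> Obj C" and L: "L \<in> Obj C"
    using Dom_Obj[of l] Cod_Obj[of l] homD[OF l] by simp_all
  have \<eta>K: "\<eta> K \<in> hom C K (FObj T K)" and \<eta>L: "\<eta> L \<in> hom C L (FObj T L)"
    using component_hom K L by (simp_all add: id_functor_def)
  have c: "c \<in> hom C G (FObj T L)" and c_pb: "is_pullback C c (\<eta> L) m (Id C L)"
    unfolding c_def using mono_classifier \<open>m \<in> M\<close> m by blast+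
  have D_pb: "is_pullback C c (FArr T l) a n'"
    unfolding c_def by fact
  \<comment> \<open>Cartesianness of \<open>\<eta>\<close> enters here; naturality alone would only
    give a commuting square.\<close>
  have nat_pb: "is_pullback C (FArr T l) (\<eta> L) (\<eta> K) l"
    using cart.naturality_pullback[OF l] by (simp add: id_functor_def)
  have cm: "c \<cdot> m = \<eta> L"
    using is_pullback_commutes[OF c_pb] Comp_Id[OF \<eta>L] by simp
  have "c \<cdot> (m \<cdot> l) = FArr T l \<cdot> \<eta> K"
    using Comp_assoc[OF l m c] cm is_pullback_commutes[OF nat_pb] by simp
  then have ex1_n: "\<exists>!n. n \<in> hom C K D \<and> n' \<cdot> n = \<eta> K \<and> a \<cdot> n = m \<cdot> l"
    using is_pullback_ex1[OF D_pb c Tl a Comp_hom[OF l m] \<eta>K] by blast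
  have "is_final_pullback_complement C l m n a"
    if n: "n \<in> hom C K D" and n'n: "n' \<cdot> n = \<eta> K" and an: "a \<cdot> n = m \<cdot> l" for n
    unfolding is_final_pullback_complement_def
  proof (intro conjI allI impI)
    \<comment> \<open>Since \<open>c \<cdot> m = \<eta> L\<close> and
      \<open>n' \<cdot> n = \<eta> K\<close>, the outer rectangle is the transposed naturality
      square; removing the square that defines \<open>D\<close> leaves condition (1).\<close>
    have "is_pullback C (c \<cdot> m) (FArr T l) l (n' \<cdot> n)"
      unfolding cm n'n by (rule is_pullback_swap[OF nat_pb])
    then show "is_pullback C a m n l"
      by (rule is_pullback_swap[OF is_pullback_left[OF D_pb _ an[symmetric] c Tl a n' m l n]])
  next
    fix d e f h
    assume "is_pullback C m f d e \<and> h \<in> hom C (Dom C d) (Dom C l) \<and> l \<cdot> h = d"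
    then have pb: "is_pullback C m f d e" and h_hom: "h \<in> hom C (Dom C d) (Dom C l)"
      and lh: "l \<cdot> h = d"
      by simp_all
    obtain K' D' where f: "f \<in> hom C D' G" and d: "d \<in> hom C K' L" and e: "e \<in> hom C K' D'"
      by (rule is_pullback_hom[OF pb]) (use homD[OF m] in \<open>simp add: hom_def\<close>)
    have h: "h \<in> hom C K' K"
      using h_hom homD(2)[OF d] homD(2)[OF l] by simp
    \<comment> \<open>As a pullback of \<open>m\<close> along \<open>f\<close>, \<open>e\<close> is
      again in \<open>M\<close>, so spans with left leg \<open>e\<close> have unique classifying
      arrows.\<close>
    have "e \<in> M"
      by (rule pullback_stable[OF \<open>m \<in> M\<close> pb])
    have "is_pullback C (c \<cdot> f) (\<eta> L) e (Id C L \<cdot> d)"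
      by (rule is_pullback_paste[OF c_pb is_pullback_swap[OF pb] c \<eta>L m Id_hom[OF L] f e d])
    then have cf_pb: "is_pullback C (c \<cdot> f) (\<eta> L) e d"
      by (simp add: Id_Comp[OF d])
    obtain p where p: "p \<in> hom C D' (FObj T K)" and p_pb: "is_pullback C p (\<eta> K) e h"
      and p_unique: "\<And>u. u \<in> hom C D' (FObj T K) \<Longrightarrow> is_pullback C u (\<eta> K) e h \<Longrightarrow> u = p"
      using classifying_arrow_ex1[OF \<open>e \<in> M\<close> e h] by blast
    \<comment> \<open>Pasting the square of \<open>p\<close> with the naturality square at
      \<open>l\<close> gives the span \<open>(e, l \<cdot> h)\<close>, which is
      \<open>(e, d)\<close>.\<close>
    have "is_pullback C (FArr T l \<cdot> p) (\<eta> L) e d"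
      using is_pullback_paste[OF nat_pb p_pb Tl \<eta>L \<eta>K l p e h] lh by simp
    then have "c \<cdot> f = FArr T l \<cdot> p"
      using classifying_arrow_ex1[OF \<open>e \<in> M\<close> e d] cf_pb Comp_hom[OF f c] Comp_hom[OF p Tl]
      by blast
    then obtain g where g: "g \<in> hom C D' D" and ag: "a \<cdot> g = f" and n'g: "n' \<cdot> g = p"
      using is_pullback_ex1[OF D_pb c Tl a f p] by blast
    \<comment> \<open>The equation \<open>g \<cdot> e = n \<cdot> h\<close> is tested on the
      projections of \<open>D\<close>: along \<open>a\<close> both sides give
      \<open>m \<cdot> d\<close>, along \<open>n'\<close> both give
      \<open>\<eta> K \<cdot> h\<close>.\<close>
    have "a \<cdot> (g \<cdot> e) = a \<cdot> (n \<cdot> h)"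
      using Comp_assoc[OF e g a] Comp_assoc[OF h n a] Comp_assoc[OF h l m] ag an lh
        is_pullback_commutes[OF pb] by simp
    moreover have "n' \<cdot> (g \<cdot> e) = n' \<cdot> (n \<cdot> h)"
      using Comp_assoc[OF e g n'] Comp_assoc[OF h n n'] n'g n'n is_pullback_commutes[OF p_pb]
      by simp
    ultimately have ge: "g \<cdot> e = n \<cdot> h"
      by (rule is_pullback_cancel_arrow[OF D_pb c Tl category_axioms a n'
            Comp_hom[OF e g] Comp_hom[OF h n]])
    show "\<exists>!g. g \<in> hom C (Dom C f) (Dom C a) \<and> a \<cdot> g = f \<and> g \<cdot> e = n \<cdot> h"
      unfolding homD(2)[OF f] homD(2)[OF a]
    proof (rule ex1I)
      show "g \<in> hom C D' D \<and> a \<cdot> g = f \<and> g \<cdot> e = n \<cdot> h"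
        using g ag ge by simp
    next
      fix g'
      assume g'_props: "g' \<in> hom C D' D \<and> a \<cdot> g' = f \<and> g' \<cdot> e = n \<cdot> h"
      then have g': "g' \<in> hom C D' D" by simp
      \<comment> \<open>Both sides equal \<open>c \<cdot> (a \<cdot> g')\<close>, so the known
        pullback \<open>cf_pb\<close> becomes an outer rectangle from which the naturality square at
        \<open>l\<close> can be removed.\<close>
      have "FArr T l \<cdot> (n' \<cdot> g') = c \<cdot> f"
        using Comp_assoc[OF g' n' Tl] Comp_assoc[OF g' a c] g'_props is_pullback_commutes[OF D_pb]
        by simp
      then have outer: "is_pullback C (FArr T l \<cdot> (n' \<cdot> g')) (\<eta> L) e (l \<cdot> h)"
        using cf_pb lh by simp
      have "(n' \<cdot> g') \<cdot> e = \<eta> K \<cdot> h"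
        using Comp_assoc[OF e g' n'] Comp_assoc[OF h n n'] n'n g'_props by simp
      then have "is_pullback C (n' \<cdot> g') (\<eta> K) e h"
        by (rule is_pullback_left[OF nat_pb outer _ Tl \<eta>L \<eta>K l Comp_hom[OF g' n'] e h])
      then have "n' \<cdot> g' = n' \<cdot> g"
        using p_unique Comp_hom[OF g' n'] n'g by simp
      \<comment> \<open>Now \<open>g\<close> and \<open>g'\<close> agree after both \<open>a\<close>
        and \<open>n'\<close>, which are jointly monic.\<close>
      then show "g' = g"
        using is_pullback_cancel_arrow[OF D_pb c Tl category_axioms a n' g' g] g'_props ag by simp
    qed
  qed
  with ex1_n show ?thesis by blast
qed

end
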